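(* Let $\varepsilon\in(0,1]$ and let $n,r,q,t\ge1$ satisfy $\varepsilon r\ge 2^{17}q\log_2 q$. Let $\mathcal{A}\subset2^{[n]}$ be an $(r,t)$-spread family and let $\mathcal{S}$ be a non-trivial $t$-intersecting family of subsets of $[n]$, each of size at most $q$. Then there exists a $t$-element set $T\subset[n]$ such that $|\mathcal{A}(\mathcal{S})|\le\varepsilon|\mathcal{A}(T)|$.
   Context: For a family $\mathcal{G}$ and a set $S$, $\mathcal{G}(S)=\{A\setminus S: A\in\mathcal{G},\ S\subset A\}$ (so $|\mathcal{A}(T)|$ is the number of members of $\mathcal{A}$ containing $T$). For a family of sets $\mathcal{S}$, $\mathcal{A}(\mathcal{S})$ denotes the family of all sets of $\mathcal{A}$ containing at least one set of $\mathcal{S}$. A family $\mathcal{G}$ is $r$-spread if $|\mathcal{G}(X)|\le r^{-|X|}|\mathcal{G}|$ for every set $X$; $\mathcal{A}\subset2^{[n]}$ is $(r,t)$-spread if $\mathcal{A}(S)$ is $r$-spread for every $S\subset[n]$ with $|S|\le t$. A family is $t$-intersecting if any two of its members share at least $t$ elements; a $t$-intersecting family $\mathcal{S}$ is non-trivial if $|\bigcap_{F\in\mathcal{S}}F|<t$. *)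

theory Defs
  imports Complex_Main
begin

definition link :: "'a set set \<Rightarrow> 'a set \<Rightarrow> 'a set set" where
  "link \<G> S = {A - S | A. A \<in> \<G> \<and> S \<subseteq> A}"

definition covered :: "'a set set \<Rightarrow> 'a set set \<Rightarrow> 'a set set" where
  "covered \<A> \<S> = {A \<in> \<A>. \<exists>S\<in>\<S>. S \<subseteq> A}"

definition spread :: "real \<Rightarrow> 'a set set \<Rightarrow> bool" where
  "spread r \<G> \<longleftrightarrow>
     (\<forall>X. finite X \<longrightarrow> real (card (link \<G> X)) \<le> r powi (- int (card X)) * real (card \<G>))"

definition rt_spread :: "nat \<Rightarrow> real \<Rightarrow> nat \<Rightarrow> nat set set \<Rightarrow> bool" where
  "rt_spread n r t \<A> \<longleftrightarrow> (\<forall>S \<subseteq> {1..n}. card S \<le> t \<longrightarrow> spread r (link \<A> S))"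

text \<open>The two members are not required to be distinct, so every member of a \<open>t\<close>-intersecting
  family has at least \<open>t\<close> elements.\<close>

definition t_intersecting :: "nat \<Rightarrow> 'a set set \<Rightarrow> bool" where
  "t_intersecting t \<S> \<longleftrightarrow> (\<forall>F\<in>\<S>. \<forall>G\<in>\<S>. card (F \<inter> G) \<ge> t)"

text \<open>The empty family counts as trivial; its intersection is \<open>UNIV\<close>, whose \<open>card\<close> is
  \<open>0\<close> on an infinite type.\<close>

definition nontrivial_t_intersecting :: "nat \<Rightarrow> 'a set set \<Rightarrow> bool" where
  "nontrivial_t_intersecting t \<S> \<longleftrightarrow> t_intersecting t \<S> \<and> \<S> \<noteq> {} \<and> card (\<Inter>\<S>) < t"

end

theory Submission
  imports Defs
begin

text \<open>
  Pass from \<open>\<S>\<close> to a \<open>t\<close>-intersecting family \<open>\<B>\<close> of sets of size at most \<open>k\<close> in which no member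
  can be replaced by a proper subset. Put \<open>m = k - t\<close> and let \<open>W\<close> be the members of size exactly
  \<open>k\<close>. A proper subset \<open>X\<close> of a member meets some \<open>G \<in> \<B>\<close> in only \<open>t - s\<close> elements, \<open>s \<ge> 1\<close>, so
  every member containing \<open>X\<close> contains \<open>s\<close> further elements of \<open>G - X\<close>, a set of size at most
  \<open>m + s\<close>. As \<open>(m + s) choose s \<le> (m + 1) ^ s\<close>, at most \<open>(m + 1) ^ m\<close> members of \<open>W\<close> contain a given
  \<open>t\<close>-set, whence \<open>card W \<le> (k choose t) * (m + 1) ^ m \<le> (4 * k) ^ m\<close>, while each member of \<open>W\<close>
  accounts for at most a proportion \<open>r ^ (-m)\<close> of the largest \<open>\<A>(T)\<close>. Peel off \<open>W\<close> and repeat with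
  \<open>k - 1\<close>. If the remaining sets all contain a \<open>t\<close>-set \<open>T\<close>, then some \<open>F \<in> \<B>\<close> does not, and every
  remaining set contains \<open>T\<close> and an element of \<open>F - T\<close>.
\<close>

section \<open>Numerical estimates\<close>

text \<open>Raising \<open>s\<close> by one multiplies the binomial by
  \<open>(m + s + 1) / (s + 1)\<close>, which is at most \<open>m + 1\<close>.\<close>

lemma binomial_add_le_power: "(m + s) choose s \<le> (m + 1) ^ s"
proof (induction s)
  case (Suc s)
  have "Suc s * ((m + Suc s) choose Suc s) = (m + s + 1) * ((m + s) choose s)"
    using Suc_times_binomial_eq[of "m + s" s] by (simp add: mult.commute)
  also have "\<dots> \<le> (Suc s * (m + 1)) * (m + 1) ^ s"
    by (rule mult_mono) (use Suc.IH in auto)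
  also have "\<dots> = Suc s * (m + 1) ^ Suc s"
    by (simp only: power_Suc mult.assoc)
  finally show ?case
    by (simp only: Suc_mult_le_cancel1)
qed simp

text \<open>Passing from \<open>m\<close> to \<open>m + 1\<close> multiplies the left side by
  \<open>(m + 1) * (1 + 1 / (m + 1)) ^ (m + 1)\<close>, at most \<open>exp 1 * (m + 1)\<close>, and
  the right side by \<open>4 * (m + 1)\<close>.\<close>

lemma Suc_power_le_fact: "real ((m + 1) ^ m) \<le> 4 ^ m * fact m"
proof (induction m)
  case (Suc m)
  have "(1 + 1 / real (m + 1)) ^ (m + 1) \<le> exp 1"
    using exp_ge_one_plus_x_over_n_power_n[of "m + 1" 1] by simp
  also have "\<dots> \<le> (4 :: real)"
    using exp_le by simp
  finally have *: "(1 + 1 / real (m + 1)) ^ (m + 1) \<le> 4" .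
  have "real (Suc m + 1) = (1 + 1 / real (m + 1)) * real (m + 1)"
    by (simp add: field_simps)
  then have "real ((Suc m + 1) ^ Suc m) = ((1 + 1 / real (m + 1)) * real (m + 1)) ^ (m + 1)"
    by (simp only: of_nat_power Suc_eq_plus1)
  also have "\<dots> = (1 + 1 / real (m + 1)) ^ (m + 1) * (real (m + 1) * real ((m + 1) ^ m))"
    by (simp only: power_mult_distrib) simp
  also have "\<dots> \<le> 4 * (real (m + 1) * (4 ^ m * fact m))"
    by (intro mult_mono * Suc.IH) auto
  also have "\<dots> = 4 ^ Suc m * fact (Suc m)"
    by simp
  finally show ?case .
qed simp

text \<open>The factorial cancels between
  \<open>((t + m) choose t) * fact m \<le> (t + m) ^ m\<close> and
  \<open>(m + 1) ^ m \<le> 4 ^ m * fact m\<close>. What remains is an \<open>m\<close>-th power, to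
  be weighed against \<open>r ^ m\<close>.\<close>

lemma binomial_times_Suc_power_le: "real (((t + m) choose t) * (m + 1) ^ m) \<le> (4 * real (t + m)) ^ m"
proof -
  have "real ((t + m) choose t) * fact m \<le> real (t + m) ^ m"
    using binomial_fact_pow[of "t + m" m] binomial_symmetric[of t "t + m"]
    by (metis add_diff_cancel_left' le_add1 of_nat_fact of_nat_le_iff of_nat_mult of_nat_power)
  then have "4 ^ m * (real ((t + m) choose t) * fact m) \<le> 4 ^ m * real (t + m) ^ m"
    by (rule mult_left_mono) simp
  then have "real ((t + m) choose t) * (4 ^ m * fact m) \<le> (4 * real (t + m)) ^ m"
    by (simp only: power_mult_distrib mult_ac)
  moreover have "real (((t + m) choose t) * (m + 1) ^ m)
      \<le> real ((t + m) choose t) * (4 ^ m * fact m)"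
    unfolding of_nat_mult by (intro mult_left_mono Suc_power_le_fact) simp
  ultimately show ?thesis by linarith
qed

lemma sum_powers_le_twice:
  fixes x :: real
  assumes "0 \<le> x" "x \<le> 1 / 2"
  shows "(\<Sum>m = 1..N. x ^ m) \<le> 2 * x"
proof -
  \<comment> \<open>Counting the last term twice makes the induction close, since
    \<open>2 * x ^ (N + 2) \<le> x ^ (N + 1)\<close>.\<close>
  have "(\<Sum>m = 1..Suc N. x ^ m) + x ^ Suc N \<le> 2 * x" for N
  proof (induction N)
    case (Suc N)
    have "2 * x ^ Suc (Suc N) \<le> x ^ Suc N"
      using assms mult_right_mono[of "2 * x" 1 "x ^ Suc N"] by simp
    with Suc.IH show ?case by simp
  qed simp
  from this[of N] have "(\<Sum>m = 1..N. x ^ m) + 2 * x ^ Suc N \<le> 2 * x"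
    by simp
  moreover have "0 \<le> x ^ Suc N"
    using assms by (intro zero_le_power)
  ultimately show ?thesis by linarith
qed

section \<open>Covered families, links and spreadness\<close>

lemma covered_mono:
  assumes "\<And>S. S \<in> \<S> \<Longrightarrow> \<exists>B\<in>\<B>. B \<subseteq> S"
  shows "covered \<A> \<S> \<subseteq> covered \<A> \<B>"
proof
  fix A assume "A \<in> covered \<A> \<S>"
  then obtain S where "A \<in> \<A>" "S \<in> \<S>" "S \<subseteq> A"
    unfolding covered_def by blast
  moreover obtain B where "B \<in> \<B>" "B \<subseteq> S"
    using assms \<open>S \<in> \<S>\<close> by blast
  ultimately show "A \<in> covered \<A> \<B>"
    unfolding covered_def by blast
qed

lemma card_covered_le:
  assumes "finite \<B>" and "finite \<A>" and "\<And>B. B \<in> \<B> \<Longrightarrow> real (card (covered \<A> {B})) \<le> c"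
  shows "real (card (covered \<A> \<B>)) \<le> real (card \<B>) * c"
proof -
  have "covered \<A> \<B> = (\<Union>B\<in>\<B>. covered \<A> {B})"
    unfolding covered_def by blast
  then have "card (covered \<A> \<B>) \<le> (\<Sum>B\<in>\<B>. card (covered \<A> {B}))"
    using card_UN_le[OF \<open>finite \<B>\<close>] by simp
  then have "real (card (covered \<A> \<B>)) \<le> (\<Sum>B\<in>\<B>. real (card (covered \<A> {B})))"
    by (metis of_nat_le_iff of_nat_sum)
  also have "\<dots> \<le> real (card \<B>) * c"
    by (rule sum_bounded_above) (rule assms(3))
  finally show ?thesis .
qed

text \<open>Removing \<open>X\<close> is injective on sets containing \<open>X\<close>. Spread
  bounds on links thus become bounds on the members covered by a single set.\<close>

lemma card_link: "card (link \<A> X) = card (covered \<A> {X})"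
proof -
  have "link \<A> X = (\<lambda>A. A - X) ` covered \<A> {X}"
    unfolding link_def covered_def by auto
  moreover have "inj_on (\<lambda>A. A - X) (covered \<A> {X})"
    unfolding inj_on_def covered_def by blast
  ultimately show ?thesis
    by (simp add: card_image)
qed

lemma link_link:
  assumes "T \<subseteq> F"
  shows "link (link \<A> T) (F - T) = link \<A> F"
proof (intro equalityI subsetI)
  fix Z assume "Z \<in> link (link \<A> T) (F - T)"
  then obtain A where "A \<in> \<A>" "T \<subseteq> A" "F - T \<subseteq> A - T" "Z = A - T - (F - T)"
    unfolding link_def by blast
  moreover from this have "F \<subseteq> A" "Z = A - F"
    using assms by auto
  ultimately show "Z \<in> link \<A> F"
    unfolding link_def by blast
next
  fix Z assume "Z \<in> link \<A> F"
  then obtain A where "A \<in> \<A>" "F \<subseteq> A" "Z = A - F"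
    unfolding link_def by blast
  moreover from this have "A - T \<in> link \<A> T" "F - T \<subseteq> A - T" "Z = (A - T) - (F - T)"
    using assms unfolding link_def by auto
  ultimately show "Z \<in> link (link \<A> T) (F - T)"
    unfolding link_def[of "link \<A> T"] by blast
qed

text \<open>Spreadness is given only for links at sets of size at most \<open>t\<close>, so
  \<open>F\<close> is reached through a \<open>t\<close>-subset \<open>T\<close>: the link at
  \<open>F\<close> is the link of \<open>link \<A> T\<close> at the \<open>m\<close> elements of
  \<open>F - T\<close>, which costs a factor \<open>r ^ m\<close>.\<close>

lemma rt_spread_card_covered_le:
  assumes "rt_spread n r t \<A>" and "0 < r" and "F \<subseteq> {1..n}" and "card F = t + m"
    and M: "\<And>T. T \<subseteq> {1..n} \<Longrightarrow> card T = t \<Longrightarrow> card (link \<A> T) \<le> M"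
  shows "real (card (covered \<A> {F})) \<le> real M / r ^ m"
proof -
  have "finite F"
    using assms(3) finite_subset by blast
  obtain T where T: "T \<subseteq> F" "card T = t"
    using obtain_subset_with_card_n[of t F] assms(4) by auto
  then have "spread r (link \<A> T)"
    using assms(1,3) unfolding rt_spread_def by auto
  moreover have "card (F - T) = m"
    using T assms(4) \<open>finite F\<close> by (simp add: card_Diff_subset finite_subset)
  ultimately have "real (card (link \<A> F)) \<le> r powi (- int m) * real (card (link \<A> T))"
    using link_link[OF T(1)] \<open>finite F\<close> unfolding spread_def by (metis finite_Diff)
  also have "\<dots> = real (card (link \<A> T)) / r ^ m"
    by (simp add: power_int_minus divide_inverse mult.commute)
  also have "\<dots> \<le> real M / r ^ m"
    using M[of T] T assms(2,3) by (intro divide_right_mono) auto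
  finally show ?thesis
    by (simp add: card_link)
qed

section \<open>Reduction to a family with irreplaceable members\<close>

lemma t_intersecting_mono: "t_intersecting t \<B> \<Longrightarrow> \<C> \<subseteq> \<B> \<Longrightarrow> t_intersecting t \<C>"
  unfolding t_intersecting_def by blast

text \<open>Take a family of least total size among the nontrivial ones that still cover everything
  \<open>\<S>\<close> covers. Replacing a member by a proper subset keeps the covering property and
  only shrinks the common intersection, so by minimality it must break
  \<open>t\<close>-intersection.\<close>

lemma exists_reduced_family:
  assumes "finite V" and "\<S> \<subseteq> Pow V" and "\<forall>F\<in>\<S>. card F \<le> k"
    and "nontrivial_t_intersecting t \<S>"
  obtains \<B> where "\<B> \<subseteq> Pow V" and "\<forall>F\<in>\<B>. card F \<le> k"
    and "nontrivial_t_intersecting t \<B>" and "\<And>S. S \<in> \<S> \<Longrightarrow> \<exists>B\<in>\<B>. B \<subseteq> S"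
    and "\<And>F X. F \<in> \<B> \<Longrightarrow> X \<subset> F \<Longrightarrow> \<exists>G\<in>\<B>. card (X \<inter> G) < t"
proof -
  define P where "P \<B> \<longleftrightarrow> \<B> \<subseteq> Pow V \<and> (\<forall>F\<in>\<B>. card F \<le> k) \<and> nontrivial_t_intersecting t \<B> \<and>
    (\<forall>S\<in>\<S>. \<exists>B\<in>\<B>. B \<subseteq> S)" for \<B>
  have "P \<S>"
    using assms unfolding P_def by blast
  then obtain \<B> where "P \<B>" and least: "\<And>\<C>. P \<C> \<Longrightarrow> sum card \<B> \<le> sum card \<C>"
    using ex_has_least_nat[of P \<S> "sum card"] by blast
  have reduced: "\<exists>G\<in>\<B>. card (X \<inter> G) < t" if "F \<in> \<B>" "X \<subset> F" for F X
  proof (rule ccontr)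
    assume "\<not> ?thesis"
    then have X: "\<And>G. G \<in> \<B> \<Longrightarrow> t \<le> card (X \<inter> G)"
      by (meson not_less)
    define \<C> where "\<C> = insert X (\<B> - {F})"
    have fin: "finite \<B>" "finite F"
      using \<open>P \<B>\<close> assms(1) that unfolding P_def by (auto intro: finite_subset)
    \<comment> \<open>The case \<open>G = F\<close> supplies the bound for the pair of
      \<open>X\<close> with itself.\<close>
    have "t \<le> card X"
      using X[OF that(1)] that(2) by (metis inf.absorb1 psubset_imp_subset)
    then have "t_intersecting t \<C>"
      using \<open>P \<B>\<close> X unfolding P_def \<C>_def nontrivial_t_intersecting_def t_intersecting_def
      by (auto simp: Int_commute)
    moreover have "card (\<Inter>\<C>) \<le> card (\<Inter>\<B>)"
    proof (rule card_mono)
      show "finite (\<Inter>\<B>)"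
        using that(1) fin(2) by (meson Inter_lower finite_subset)
      show "\<Inter>\<C> \<subseteq> \<Inter>\<B>"
        using that unfolding \<C>_def by auto
    qed
    ultimately have "nontrivial_t_intersecting t \<C>"
      using \<open>P \<B>\<close> unfolding P_def nontrivial_t_intersecting_def \<C>_def by auto
    moreover have "card X \<le> k" "X \<subseteq> V"
      using \<open>P \<B>\<close> that card_mono[OF fin(2), of X] unfolding P_def by force+
    moreover have "\<exists>B\<in>\<C>. B \<subseteq> S" if "S \<in> \<S>" for S
    proof -
      obtain B where "B \<in> \<B>" "B \<subseteq> S"
        using \<open>P \<B>\<close> \<open>S \<in> \<S>\<close> unfolding P_def by blast
      then show ?thesis
        using \<open>X \<subset> F\<close> unfolding \<C>_def by (cases "B = F") auto
    qed
    ultimately have "P \<C>"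
      using \<open>P \<B>\<close> unfolding P_def \<C>_def by auto
    \<comment> \<open>Only an inequality, because \<open>X\<close> may already belong to
      \<open>\<B>\<close>.\<close>
    have "sum card \<C> \<le> card X + sum card (\<B> - {F})"
      unfolding \<C>_def using fin by (simp add: sum.insert_if)
    also have "\<dots> < card F + sum card (\<B> - {F})"
      using psubset_card_mono[OF fin(2) that(2)] by simp
    also have "\<dots> = sum card \<B>"
      using sum.remove[OF fin(1) that(1), of card] by simp
    finally show False
      using least[OF \<open>P \<C>\<close>] by simp
  qed
  show thesis
    by (rule that[OF _ _ _ _ reduced]) (use \<open>P \<B>\<close> in \<open>auto simp: P_def\<close>)
qed

section \<open>Size of the top layer of a reduced family\<close>

text \<open>A member containing \<open>X\<close> has at least \<open>s\<close> elements in
  \<open>G - X\<close>, hence contains \<open>X \<union> Y\<close> for some \<open>s\<close>-subset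
  \<open>Y\<close> of \<open>G - X\<close>; a union bound over \<open>Y\<close> follows.\<close>

lemma card_supersets_le_binomial:
  assumes "finite \<W>" and "finite G" and "\<And>F. F \<in> \<W> \<Longrightarrow> X \<subseteq> F \<Longrightarrow> card (X \<inter> G) + s \<le> card (F \<inter> G)"
    and "\<And>Y. Y \<subseteq> G - X \<Longrightarrow> card Y = s \<Longrightarrow> card {F \<in> \<W>. X \<union> Y \<subseteq> F} \<le> c"
  shows "card {F \<in> \<W>. X \<subseteq> F} \<le> (card (G - X) choose s) * c"
proof -
  define \<Y> where "\<Y> = {Y. Y \<subseteq> G - X \<and> card Y = s}"
  have "finite \<Y>"
    using assms(2) unfolding \<Y>_def by simp
  have "{F \<in> \<W>. X \<subseteq> F} \<subseteq> (\<Union>Y\<in>\<Y>. {F \<in> \<W>. X \<union> Y \<subseteq> F})"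
  proof
    fix F assume F: "F \<in> {F \<in> \<W>. X \<subseteq> F}"
    have "F \<inter> G = (X \<inter> G) \<union> (F \<inter> (G - X))" "(X \<inter> G) \<inter> (F \<inter> (G - X)) = {}"
      using F by auto
    then have "card (F \<inter> G) = card (X \<inter> G) + card (F \<inter> (G - X))"
      using assms(2) by (metis card_Un_disjoint finite_Diff finite_Int)
    then have "s \<le> card (F \<inter> (G - X))"
      using assms(3)[of F] F by simp
    then obtain Y where "Y \<subseteq> F \<inter> (G - X)" "card Y = s"
      using obtain_subset_with_card_n by metis
    then show "F \<in> (\<Union>Y\<in>\<Y>. {F \<in> \<W>. X \<union> Y \<subseteq> F})"
      using F unfolding \<Y>_def by blast
  qed
  then have "card {F \<in> \<W>. X \<subseteq> F} \<le> card (\<Union>Y\<in>\<Y>. {F \<in> \<W>. X \<union> Y \<subseteq> F})"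
    using \<open>finite \<Y>\<close> assms(1) by (intro card_mono) auto
  also have "\<dots> \<le> (\<Sum>Y\<in>\<Y>. card {F \<in> \<W>. X \<union> Y \<subseteq> F})"
    by (rule card_UN_le[OF \<open>finite \<Y>\<close>])
  also have "\<dots> \<le> card \<Y> * c"
    using sum_bounded_above[of \<Y> "\<lambda>Y. card {F \<in> \<W>. X \<union> Y \<subseteq> F}" c] assms(4)
    unfolding \<Y>_def by simp
  also have "card \<Y> = card (G - X) choose s"
    unfolding \<Y>_def using assms(2) by (simp add: n_subsets)
  finally show ?thesis .
qed

text \<open>Strong induction on the number \<open>j\<close> of elements that \<open>X\<close> lacks.
  Adding \<open>s\<close> elements of a suitable \<open>G\<close> costs a factor at most
  \<open>(m + 1) ^ s\<close> and lowers \<open>j\<close> by \<open>s\<close>.\<close>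

lemma card_reduced_supersets_le:
  assumes "finite V" and "\<B> \<subseteq> Pow V" and "\<forall>F\<in>\<B>. card F \<le> t + m" and "t_intersecting t \<B>"
    and reduced: "\<And>F X. F \<in> \<B> \<Longrightarrow> X \<subset> F \<Longrightarrow> \<exists>G\<in>\<B>. card (X \<inter> G) < t"
    and "finite X" and "card X + j = t + m"
  shows "card {F \<in> {F \<in> \<B>. card F = t + m}. X \<subseteq> F} \<le> (m + 1) ^ j"
  using assms(6,7)
proof (induction j arbitrary: X rule: less_induct)
  case (less j)
  define \<W> where "\<W> = {F \<in> \<B>. card F = t + m}"
  have fin: "finite F" if "F \<in> \<B>" for F
    using that assms(1,2) finite_subset by blast
  have "finite \<W>"
    using assms(1,2) unfolding \<W>_def by (auto intro: finite_subset)
  consider "{F \<in> \<W>. X \<subseteq> F} = {}" | "{F \<in> \<W>. X \<subseteq> F} \<noteq> {}" "j = 0"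
    | F where "F \<in> \<W>" "X \<subseteq> F" "j > 0" by blast
  then show ?case
  proof cases
    case 1
    then show ?thesis
      unfolding \<W>_def by (metis card.empty zero_le)
  next
    case 2
    have "{F \<in> \<W>. X \<subseteq> F} \<subseteq> {X}"
    proof
      fix F assume "F \<in> {F \<in> \<W>. X \<subseteq> F}"
      then have "X = F"
        using 2 less.prems fin unfolding \<W>_def by (intro card_subset_eq) auto
      then show "F \<in> {X}" by simp
    qed
    then have "card {F \<in> \<W>. X \<subseteq> F} \<le> card {X}"
      by (intro card_mono) auto
    then show ?thesis
      using 2 unfolding \<W>_def by simp
  next
    case 3
    have "X \<noteq> F"
      using 3 less.prems unfolding \<W>_def by auto
    with 3 obtain G where G: "G \<in> \<B>" "card (X \<inter> G) < t"
      using reduced[of F X] unfolding \<W>_def by blast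
    define s where "s = t - card (X \<inter> G)"
    have s: "s > 0" "card (X \<inter> G) + s = t"
      using G unfolding s_def by auto
    have meet: "card (X \<inter> G) + s \<le> card (F' \<inter> G)" if "F' \<in> \<W>" for F'
      using that G assms(4) s unfolding t_intersecting_def \<W>_def by auto
    \<comment> \<open>This keeps \<open>j - s\<close> from being truncated: \<open>F\<close> can
      make up its \<open>s\<close> missing elements of \<open>G\<close> only from the
      \<open>j\<close> elements of \<open>F - X\<close>.\<close>
    have "s \<le> j"
    proof -
      have "F \<inter> G \<subseteq> (X \<inter> G) \<union> (F - X)"
        by auto
      then have "card (F \<inter> G) \<le> card ((X \<inter> G) \<union> (F - X))"
        using fin 3 less.prems unfolding \<W>_def by (intro card_mono) auto
      also have "\<dots> \<le> card (X \<inter> G) + card (F - X)"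
        by (rule card_Un_le)
      also have "card (F - X) = j"
        using 3 less.prems unfolding \<W>_def by (simp add: card_Diff_subset)
      finally show ?thesis
        using meet[OF 3(1)] by simp
    qed
    have "card {F \<in> \<W>. X \<subseteq> F} \<le> (card (G - X) choose s) * (m + 1) ^ (j - s)"
    proof (rule card_supersets_le_binomial[OF \<open>finite \<W>\<close> fin[OF G(1)] meet])
      fix Y assume Y: "Y \<subseteq> G - X" "card Y = s"
      have "finite Y"
        using Y s(1) card_gt_0_iff by metis
      moreover have "X \<inter> Y = {}"
        using Y by auto
      ultimately have "card (X \<union> Y) + (j - s) = t + m"
        using less.prems Y \<open>s \<le> j\<close> by (simp add: card_Un_disjoint)
      then show "card {F \<in> \<W>. X \<union> Y \<subseteq> F} \<le> (m + 1) ^ (j - s)"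
        using less.IH[of "j - s" "X \<union> Y"] s(1) \<open>s \<le> j\<close> \<open>finite Y\<close> less.prems
        unfolding \<W>_def by auto
    qed
    also have "card (G - X) choose s \<le> (m + s) choose s"
    proof (rule binomial_right_mono)
      have "card (G - X) + card (X \<inter> G) = card G"
        using fin[OF G(1)] by (metis Int_commute card_Diff_subset_Int card_mono finite_Int inf_le1
            le_add_diff_inverse2)
      then show "card (G - X) \<le> m + s"
        using assms(3) G s by force
    qed
    also have "(m + s) choose s \<le> (m + 1) ^ s"
      by (rule binomial_add_le_power)
    also have "(m + 1) ^ s * (m + 1) ^ (j - s) = (m + 1) ^ j"
      using \<open>s \<le> j\<close> by (metis le_add_diff_inverse power_add)
    finally show ?thesis
      unfolding \<W>_def by simp
  qed
qed

text \<open>Counting from the empty set by the previous lemma would give the exponent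
  \<open>t + m\<close>. Instead the first \<open>t\<close> elements are chosen inside one member
  \<open>G\<close> of the layer, which every member meets in at least \<open>t\<close> elements, and
  only the remaining \<open>m\<close> cost a factor \<open>m + 1\<close> each.\<close>

lemma card_reduced_layer_le:
  assumes "finite V" and "\<B> \<subseteq> Pow V" and "\<forall>F\<in>\<B>. card F \<le> t + m" and "t_intersecting t \<B>"
    and "\<And>F X. F \<in> \<B> \<Longrightarrow> X \<subset> F \<Longrightarrow> \<exists>G\<in>\<B>. card (X \<inter> G) < t"
  shows "card {F \<in> \<B>. card F = t + m} \<le> ((t + m) choose t) * (m + 1) ^ m"
proof (cases "{F \<in> \<B>. card F = t + m} = {}")
  case True
  then show ?thesis by (metis card.empty zero_le)
next
  case False
  define \<W> where "\<W> = {F \<in> \<B>. card F = t + m}"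
  obtain G where G: "G \<in> \<B>" "card G = t + m"
    using False by blast
  have "card {F \<in> \<W>. {} \<subseteq> F} \<le> (card (G - {}) choose t) * (m + 1) ^ m"
  proof (rule card_supersets_le_binomial)
    show "finite \<W>" "finite G"
      using assms(1,2) G unfolding \<W>_def by (auto intro: finite_subset)
    show "card ({} \<inter> G) + t \<le> card (F \<inter> G)" if "F \<in> \<W>" for F
      using that G assms(4) unfolding \<W>_def t_intersecting_def by simp
    show "card {F \<in> \<W>. {} \<union> Y \<subseteq> F} \<le> (m + 1) ^ m" if "Y \<subseteq> G - {}" "card Y = t" for Y
      using card_reduced_supersets_le[OF assms, where X = Y and j = m] that \<open>finite G\<close>
      unfolding \<W>_def by (auto dest: finite_subset)
  qed
  then show ?thesis
    using G unfolding \<W>_def by simp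
qed

section \<open>Trivial families\<close>

text \<open>Each member \<open>G\<close> has at most \<open>t\<close> elements and shares at least
  \<open>t\<close> with every other member, so it lies in all of them and is the common
  intersection.\<close>

lemma no_nontrivial_t_intersecting_uniform:
  assumes "finite V" and "\<S> \<subseteq> Pow V" and "\<forall>F\<in>\<S>. card F \<le> t"
  shows "\<not> nontrivial_t_intersecting t \<S>"
proof
  assume nt: "nontrivial_t_intersecting t \<S>"
  then obtain G where G: "G \<in> \<S>"
    unfolding nontrivial_t_intersecting_def by blast
  have "G \<subseteq> F" if "F \<in> \<S>" for F
  proof -
    have "finite G"
      using G assms(1,2) finite_subset by blast
    moreover have "card G \<le> card (F \<inter> G)"
      using nt G that assms(3) unfolding nontrivial_t_intersecting_def t_intersecting_def
      by (meson le_trans)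
    ultimately have "F \<inter> G = G"
      by (intro card_seteq) auto
    then show ?thesis by blast
  qed
  then have "\<Inter>\<S> = G"
    using G by auto
  moreover have "t \<le> card G"
    using nt G unfolding nontrivial_t_intersecting_def t_intersecting_def by force
  ultimately show False
    using nt unfolding nontrivial_t_intersecting_def by simp
qed

lemma card_covered_trivial_subfamily_le:
  assumes "rt_spread n r t \<A>" and "0 < r" and "\<A> \<subseteq> Pow {1..n}"
    and M: "\<And>T. T \<subseteq> {1..n} \<Longrightarrow> card T = t \<Longrightarrow> card (link \<A> T) \<le> M"
    and "\<B> \<subseteq> Pow {1..n}" and "\<forall>F\<in>\<B>. card F \<le> q" and "nontrivial_t_intersecting t \<B>"
    and "\<C> \<subseteq> \<B>" and "\<not> nontrivial_t_intersecting t \<C>"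
  shows "real (card (covered \<A> \<C>)) \<le> real q / r * real M"
\<comment> \<open>The empty family is trivial by convention, and its intersection
  \<open>UNIV\<close> provides no \<open>t\<close>-set inside the members of
  \<open>\<B>\<close>.\<close>
proof (cases "\<C> = {}")
  case True
  then show ?thesis
    using assms(2) by (simp add: covered_def)
next
  case False
  have tB: "t_intersecting t \<B>"
    using assms(7) unfolding nontrivial_t_intersecting_def by blast
  then have "t \<le> card (\<Inter>\<C>)"
    using False assms(8,9) t_intersecting_mono[OF _ assms(8)]
    unfolding nontrivial_t_intersecting_def by auto
  then obtain T where T: "T \<subseteq> \<Inter>\<C>" "card T = t"
    using obtain_subset_with_card_n by metis
  have Tn: "T \<subseteq> {1..n}"
    using T False assms(5,8) by blast
  then have "finite T"
    using finite_subset by blast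
  obtain F where F: "F \<in> \<B>" "\<not> T \<subseteq> F"
  proof (rule ccontr)
    assume "\<not> thesis"
    then have "T \<subseteq> \<Inter>\<B>"
      using that by blast
    moreover have "finite (\<Inter>\<B>)"
      using False assms(5,8) by (meson Inter_lower PowD all_not_in_conv finite_atLeastAtMost
          finite_subset subsetD)
    ultimately have "t \<le> card (\<Inter>\<B>)"
      using T card_mono by metis
    then show False
      using assms(7) unfolding nontrivial_t_intersecting_def by simp
  qed
  have Fn: "F \<subseteq> {1..n}" "finite F"
    using F assms(5) finite_subset by blast+
  \<comment> \<open>A member of \<open>\<C>\<close> contains \<open>T\<close> and meets
    \<open>F\<close> in at least \<open>t\<close> elements, while \<open>T \<inter> F\<close> has
    fewer; so it contains one of these at most \<open>q\<close> sets of size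
    \<open>t + 1\<close>.\<close>
  define \<D> where "\<D> = (\<lambda>y. insert y T) ` (F - T)"
  have "finite \<D>"
    unfolding \<D>_def using Fn by simp
  have "finite \<A>"
    using assms(3) by (rule finite_subset) simp
  have "\<exists>D\<in>\<D>. D \<subseteq> G" if "G \<in> \<C>" for G
  proof (rule ccontr)
    assume "\<not> ?thesis"
    then have "G \<inter> F \<subseteq> T \<inter> F"
      using T that unfolding \<D>_def by auto
    moreover have "T \<inter> F \<subset> T"
      using F by blast
    ultimately have "card (G \<inter> F) < t"
      using \<open>finite T\<close> T(2) by (metis psubset_card_mono subset_psubset_trans)
    moreover have "t \<le> card (G \<inter> F)"
      using tB that F assms(8) unfolding t_intersecting_def by blast
    ultimately show False by simp
  qed
  then have "card (covered \<A> \<C>) \<le> card (covered \<A> \<D>)"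
    using \<open>finite \<A>\<close> by (intro card_mono covered_mono) (auto simp: covered_def)
  also have "real (card (covered \<A> \<D>)) \<le> real (card \<D>) * (real M / r)"
  proof (rule card_covered_le[OF \<open>finite \<D>\<close> \<open>finite \<A>\<close>])
    fix D assume "D \<in> \<D>"
    then have "D \<subseteq> {1..n}" "card D = t + 1"
      using Fn Tn T \<open>finite T\<close> unfolding \<D>_def by auto
    from rt_spread_card_covered_le[OF assms(1,2) this M]
    show "real (card (covered \<A> {D})) \<le> real M / r"
      by simp
  qed
  also have "\<dots> \<le> real q * (real M / r)"
  proof (rule mult_right_mono)
    have "card \<D> \<le> card (F - T)"
      unfolding \<D>_def using Fn by (intro card_image_le) simp
    also have "\<dots> \<le> card F"
      using Fn by (intro card_mono) auto
    also have "\<dots> \<le> q"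
      using F assms(6) by blast
    finally show "real (card \<D>) \<le> real q" by simp
  qed (use assms(2) in simp)
  finally show ?thesis by simp
qed

section \<open>Peeling the layers and summing the geometric series\<close>

text \<open>Each peeled layer contributes one power of \<open>4 * q / r\<close>. The term
  \<open>q / r\<close> is paid once, since a trivial remainder ends the recursion. Removing a layer
  may destroy irreplaceability, so the induction ranges over arbitrary nontrivial families and each
  step reduces afresh.\<close>

lemma card_covered_nontrivial_le:
  assumes "rt_spread n r t \<A>" and "0 < r" and "\<A> \<subseteq> Pow {1..n}"
    and M: "\<And>T. T \<subseteq> {1..n} \<Longrightarrow> card T = t \<Longrightarrow> card (link \<A> T) \<le> M"
    and "t + N \<le> q" and "\<S> \<subseteq> Pow {1..n}" and "\<forall>F\<in>\<S>. card F \<le> t + N"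
    and "nontrivial_t_intersecting t \<S>"
  shows "real (card (covered \<A> \<S>)) \<le> (real q / r + (\<Sum>m = 1..N. (4 * real q / r) ^ m)) * real M"
  using assms(5-)
proof (induction N arbitrary: \<S>)
  case 0
  then show ?case
    using no_nontrivial_t_intersecting_uniform[of "{1..n}" \<S> t] by simp
next
  case (Suc N)
  have "finite \<A>"
    using assms(3) by (rule finite_subset) simp
  obtain \<B> where \<B>: "\<B> \<subseteq> Pow {1..n}" "\<forall>F\<in>\<B>. card F \<le> t + Suc N"
      "nontrivial_t_intersecting t \<B>" "\<And>S. S \<in> \<S> \<Longrightarrow> \<exists>B\<in>\<B>. B \<subseteq> S"
    and reduced: "\<And>F X. F \<in> \<B> \<Longrightarrow> X \<subset> F \<Longrightarrow> \<exists>G\<in>\<B>. card (X \<inter> G) < t"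
    by (rule exists_reduced_family[OF finite_atLeastAtMost Suc.prems(2-4)]) (rule that)
  have tB: "t_intersecting t \<B>"
    using \<B>(3) unfolding nontrivial_t_intersecting_def by blast
  define \<W> where "\<W> = {F \<in> \<B>. card F = t + Suc N}"
  define \<C> where "\<C> = \<B> - \<W>"
  have "finite \<W>"
    using \<B>(1) unfolding \<W>_def by (auto intro: finite_subset)
  have "real (card \<W>) \<le> real (((t + Suc N) choose t) * (Suc N + 1) ^ Suc N)"
    unfolding \<W>_def of_nat_le_iff
    by (rule card_reduced_layer_le[OF finite_atLeastAtMost \<B>(1,2) tB reduced])
  also have "\<dots> \<le> (4 * real (t + Suc N)) ^ Suc N"
    by (rule binomial_times_Suc_power_le)
  \<comment> \<open>The bound \<open>q\<close> in place of \<open>t + Suc N\<close> gives all layers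
    the same ratio.\<close>
  also have "\<dots> \<le> (4 * real q) ^ Suc N"
    using Suc.prems(1) by (intro power_mono) auto
  finally have cardW: "real (card \<W>) \<le> (4 * real q) ^ Suc N" .
  have "real (card (covered \<A> \<W>)) \<le> real (card \<W>) * (real M / r ^ Suc N)"
  proof (rule card_covered_le[OF \<open>finite \<W>\<close> \<open>finite \<A>\<close>])
    fix F assume "F \<in> \<W>"
    then show "real (card (covered \<A> {F})) \<le> real M / r ^ Suc N"
      using rt_spread_card_covered_le[OF assms(1,2) _ _ M, of F "Suc N"] \<B>(1)
      unfolding \<W>_def by blast
  qed
  also have "\<dots> \<le> (4 * real q) ^ Suc N * (real M / r ^ Suc N)"
    using cardW assms(2) by (intro mult_right_mono) auto
  also have "\<dots> = (4 * real q / r) ^ Suc N * real M"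
    by (simp only: power_divide) simp
  finally have W: "real (card (covered \<A> \<W>)) \<le> (4 * real q / r) ^ Suc N * real M" .
  have C: "real (card (covered \<A> \<C>)) \<le> (real q / r + (\<Sum>m = 1..N. (4 * real q / r) ^ m)) * real M"
  proof (cases "nontrivial_t_intersecting t \<C>")
    case True
    have "\<forall>F\<in>\<C>. card F \<le> t + N"
      using \<B>(2) unfolding \<C>_def \<W>_def by force
    then show ?thesis
      using Suc.IH[of \<C>] Suc.prems(1) \<B>(1) True unfolding \<C>_def by auto
  next
    case False
    have "\<forall>F\<in>\<B>. card F \<le> q"
      using \<B>(2) Suc.prems(1) by force
    then have "real (card (covered \<A> \<C>)) \<le> real q / r * real M"
      using card_covered_trivial_subfamily_le[OF assms(1-3) M \<B>(1) _ \<B>(3) _ False]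
      unfolding \<C>_def by blast
    also have "\<dots> \<le> (real q / r + (\<Sum>m = 1..N. (4 * real q / r) ^ m)) * real M"
      using assms(2) by (intro mult_right_mono) (auto intro!: sum_nonneg)
    finally show ?thesis .
  qed
  have "covered \<A> \<S> \<subseteq> covered \<A> \<B>"
    using \<B>(4) by (rule covered_mono)
  also have "\<dots> = covered \<A> \<W> \<union> covered \<A> \<C>"
    unfolding covered_def \<C>_def \<W>_def by blast
  finally have "card (covered \<A> \<S>) \<le> card (covered \<A> \<W> \<union> covered \<A> \<C>)"
    using \<open>finite \<A>\<close> by (intro card_mono) (auto simp: covered_def)
  also have "\<dots> \<le> card (covered \<A> \<W>) + card (covered \<A> \<C>)"
    by (rule card_Un_le)
  finally have "real (card (covered \<A> \<S>)) \<le> real (card (covered \<A> \<W>)) + real (card (covered \<A> \<C>))"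
    by linarith
  with W C show ?case
    by (simp add: algebra_simps)
qed

theorem theorem7:
  fixes \<epsilon> r :: real and n q t :: nat and \<A> \<S> :: "nat set set"
  assumes "0 < \<epsilon>" and "\<epsilon> \<le> 1"
    and "n \<ge> 1" and "r \<ge> 1" and "q \<ge> 1" and "t \<ge> 1"
    and "\<epsilon> * r \<ge> 2 ^ 17 * real q * log 2 (real q)"
    and "\<A> \<subseteq> Pow {1..n}" and "rt_spread n r t \<A>"
    and "\<S> \<subseteq> Pow {1..n}" and "\<forall>F\<in>\<S>. card F \<le> q"
    and "nontrivial_t_intersecting t \<S>"
  shows "\<exists>T \<subseteq> {1..n}. card T = t \<and>
           real (card (covered \<A> \<S>)) \<le> \<epsilon> * real (card (link \<A> T))"
proof -
  \<comment> \<open>Together with \<open>t \<ge> 1\<close> this gives \<open>q \<ge> 2\<close>,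
    hence \<open>log 2 q \<ge> 1\<close> and \<open>2 ^ 17 * q \<le> \<epsilon> * r\<close>.\<close>
  have "t < q"
  proof (rule ccontr)
    assume "\<not> t < q"
    then have "\<forall>F\<in>\<S>. card F \<le> t"
      using assms(11) by force
    then show False
      using no_nontrivial_t_intersecting_uniform[of "{1..n}" \<S> t] assms(10,12) by simp
  qed
  then have "log 2 (real q) \<ge> 1"
    using assms(6) by (simp add: le_log_iff)
  then have "2 ^ 17 * real q * 1 \<le> 2 ^ 17 * real q * log 2 (real q)"
    by (intro mult_left_mono) auto
  then have er: "2 ^ 17 * real q \<le> \<epsilon> * r"
    using assms(7) by linarith
  define x where "x = real q / r"
  have "x \<ge> 0"
    unfolding x_def using assms(4) by simp
  have x: "2 ^ 17 * x \<le> \<epsilon>"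
    using er assms(4) unfolding x_def by (simp add: field_simps)
  define \<T> where "\<T> = {T. T \<subseteq> {1..n} \<and> card T = t}"
  have "finite \<T>"
    unfolding \<T>_def by simp
  obtain F where "F \<in> \<S>"
    using assms(12) unfolding nontrivial_t_intersecting_def by blast
  then have "t \<le> card F"
    using assms(12) unfolding nontrivial_t_intersecting_def t_intersecting_def by force
  then obtain T0 where "T0 \<subseteq> F" "card T0 = t"
    using obtain_subset_with_card_n by metis
  \<comment> \<open>A member of \<open>\<S>\<close> has at least \<open>t\<close> elements, so there
    are \<open>t\<close>-sets over which to maximise the link.\<close>
  then have "\<T> \<noteq> {}"
    using \<open>F \<in> \<S>\<close> assms(10) unfolding \<T>_def by blast
  obtain T where T: "T \<in> \<T>" and Max: "Max ((\<lambda>T. card (link \<A> T)) ` \<T>) = card (link \<A> T)"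
    by (rule obtains_MAX[OF \<open>finite \<T>\<close> \<open>\<T> \<noteq> {}\<close>])
  have M: "card (link \<A> T') \<le> card (link \<A> T)" if "T' \<in> \<T>" for T'
    unfolding Max[symmetric] using \<open>finite \<T>\<close> that by (intro Max_ge) auto
  have "real (card (covered \<A> \<S>))
      \<le> (x + (\<Sum>m = 1..q - t. (4 * x) ^ m)) * real (card (link \<A> T))"
    using card_covered_nontrivial_le[OF assms(9) _ assms(8), of "card (link \<A> T)" "q - t" q \<S>]
      M assms(4,10-12) \<open>t < q\<close> unfolding \<T>_def x_def by simp
  also have "\<dots> \<le> \<epsilon> * real (card (link \<A> T))"
  proof (rule mult_right_mono)
    \<comment> \<open>Here \<open>4 * x \<le> 1 / 2\<close> because
      \<open>\<epsilon> \<le> 1\<close>, and the total \<open>x + 8 * x\<close> stays below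
      \<open>2 ^ 17 * x \<le> \<epsilon>\<close>.\<close>
    have "(\<Sum>m = 1..q - t. (4 * x) ^ m) \<le> 2 * (4 * x)"
      using x \<open>x \<ge> 0\<close> assms(2) by (intro sum_powers_le_twice) auto
    then show "x + (\<Sum>m = 1..q - t. (4 * x) ^ m) \<le> \<epsilon>"
      using x \<open>x \<ge> 0\<close> by simp
  qed simp
  finally show ?thesis
    using T unfolding \<T>_def by blast
qed

end
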